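(* Let $n\geq1$ and $A,C\in\mathbb{R}^{n\times n}$. Define linear operators on $\mathbb{S}^n$ by $\mathcal{L}_{(A,C)}(M)=MA+A^\top M+C^\top MC$ and $\mathcal{L}^*_{(A,C)}(M)=AM+MA^\top+CMC^\top$. The following statements are equivalent: (i) There exists a positive definite $P\in\mathbb{S}^n$ such that $\mathcal{L}_{(A,C)}(P)>0$. (ii) If $S\in\bar{\mathbb{S}}^n_+$ and $\mathcal{L}^*_{(A,C)}(S)\leq0$, then $S=0$. (iii) If $H\in\bar{\mathbb{S}}^n_+\setminus\{0\}$ and $\mathcal{L}^*_{(A,C)}(H)=\lambda H$ for some $\lambda\in\mathbb{R}$, then $\lambda>0$.
   Context: $\mathbb{S}^n$ is the space of real symmetric $n\times n$ matrices with the Frobenius inner product $\langle M,N\rangle=\mathrm{tr}(M^\top N)$, and $\bar{\mathbb{S}}^n_+$ is the set of positive semidefinite matrices in $\mathbb{S}^n$. For $M,N\in\mathbb{S}^n$, $M\geq N$ (resp. $M>N$) means that $M-N$ is positive semidefinite (resp. positive definite). $\mathcal{L}^*_{(A,C)}$ is the adjoint of $\mathcal{L}_{(A,C)}$ with respect to this inner product. *)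

theory Defs
  imports "HOL-Analysis.Analysis"
begin

definition psd :: "real ^ 'n ^ 'n \<Rightarrow> bool" where
  "psd M \<longleftrightarrow> transpose M = M \<and> (\<forall>x. 0 \<le> x \<bullet> (M *v x))"

definition pd :: "real ^ 'n ^ 'n \<Rightarrow> bool" where
  "pd M \<longleftrightarrow> transpose M = M \<and> (\<forall>x. x \<noteq> 0 \<longrightarrow> 0 < x \<bullet> (M *v x))"

text \<open>The order instance of the type \<^typ>\<open>real ^ 'n ^ 'n\<close> is componentwise, so the Loewner order
  gets its own notation.\<close>

definition loewner_le :: "real ^ 'n ^ 'n \<Rightarrow> real ^ 'n ^ 'n \<Rightarrow> bool" (infix "\<preceq>\<^sub>L" 50) where
  "M \<preceq>\<^sub>L N \<longleftrightarrow> psd (N - M)"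

definition loewner_less :: "real ^ 'n ^ 'n \<Rightarrow> real ^ 'n ^ 'n \<Rightarrow> bool" (infix "\<prec>\<^sub>L" 50) where
  "M \<prec>\<^sub>L N \<longleftrightarrow> pd (N - M)"

text \<open>Both operators are given by their formulas on all square matrices; they restrict to the
  symmetric ones by \<open>transpose_lyap\<close> and \<open>transpose_lyap_adj\<close> below.\<close>

definition lyap :: "real ^ 'n ^ 'n \<Rightarrow> real ^ 'n ^ 'n \<Rightarrow> real ^ 'n ^ 'n \<Rightarrow> real ^ 'n ^ 'n" where
  "lyap A C M = M ** A + transpose A ** M + transpose C ** M ** C"

definition lyap_adj :: "real ^ 'n ^ 'n \<Rightarrow> real ^ 'n ^ 'n \<Rightarrow> real ^ 'n ^ 'n \<Rightarrow> real ^ 'n ^ 'n" where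
  "lyap_adj A C M = A ** M + M ** transpose A + C ** M ** transpose C"

lemma transpose_add: "transpose (M + N) = transpose M + transpose (N :: real ^ 'n ^ 'm)"
  by (simp add: transpose_def vec_eq_iff)

lemma transpose_lyap:
  assumes "transpose M = M"
  shows "transpose (lyap A C M) = lyap A C M"
  using assms by (simp add: lyap_def transpose_add matrix_transpose_mul matrix_mul_assoc)

lemma transpose_lyap_adj:
  assumes "transpose M = M"
  shows "transpose (lyap_adj A C M) = lyap_adj A C M"
  using assms by (simp add: lyap_adj_def transpose_add matrix_transpose_mul matrix_mul_assoc)

text \<open>The inner product of the type \<^typ>\<open>real ^ 'n ^ 'n\<close> is the Frobenius one.\<close>

lemma matrix_mult_add_left: "(M + N) ** (K :: real ^ 'n ^ 'n) = M ** K + N ** K"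
  by (simp add: matrix_matrix_mult_def vec_eq_iff distrib_right sum.distrib)

lemma inner_matrix_eq_trace: "M \<bullet> N = trace (transpose M ** N)" for M N :: "real ^ 'n ^ 'n"
  unfolding trace_def transpose_def matrix_matrix_mult_def inner_vec_def
  by (simp, rule sum.swap)

lemma lyap_adjoint: "lyap A C M \<bullet> N = M \<bullet> lyap_adj A C N"
proof -
  have "trace (transpose A ** (transpose M ** N)) = trace ((transpose M ** N) ** transpose A)"
    by (rule trace_mul_sym)
  moreover have "trace (transpose C ** (transpose M ** C ** N)) = trace ((transpose M ** C ** N) ** transpose C)"
    by (rule trace_mul_sym)
  ultimately show ?thesis
    by (simp add: inner_matrix_eq_trace lyap_def lyap_adj_def transpose_add matrix_transpose_mul
        matrix_add_ldistrib matrix_mult_add_left trace_add matrix_mul_assoc)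
qed

end

theory Submission
  imports Defs
begin

text \<open>
  Write \<open>L\<close> for \<open>lyap A C\<close>, \<open>L*\<close> for \<open>lyap_adj A C\<close>, and \<open>tr M\<close> for \<open>mat 1 \<bullet> M\<close>.

  The equivalence of the first two statements is a theorem of the alternative. In one direction, if
  \<open>P\<close> and \<open>L P\<close> are positive definite, then a nonzero positive semidefinite \<open>S\<close> with \<open>L* S \<le> 0\<close>
  would give \<open>0 < L P \<bullet> S = P \<bullet> L* S \<le> 0\<close>. In the other direction, the matrices \<open>L* S + Q\<close> with
  \<open>S\<close>, \<open>Q\<close> positive semidefinite and \<open>tr S + tr Q = 1\<close> form a compact convex set that misses
  \<open>0\<close>. A strictly separating functional is represented by a symmetric \<open>P\<close>; evaluating it at
  \<open>S = 0\<close> shows that \<open>P\<close> is positive definite, and at \<open>Q = 0\<close> that \<open>L P\<close> is.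

  An eigenvector with eigenvalue \<open>l \<le> 0\<close> satisfies \<open>L* H \<le> 0\<close>, so the second statement implies the
  third. The converse is a Perron-Frobenius argument inside a face of the cone. Let \<open>S \<noteq> 0\<close> be
  positive semidefinite with \<open>L* S \<le> 0\<close>. Its kernel is invariant under the transposes of \<open>A\<close> and \<open>C\<close>
  (\<open>kernel_invariant\<close>), so the maps \<open>H \<mapsto> (1 + e A) H (1 + e A)^T + e C H C^T\<close>, which
  agree with \<open>1 + e L*\<close> to first order in \<open>e\<close>, preserve the face of all positive semidefinite \<open>H\<close> whose
  kernel contains that of \<open>S\<close>. Brouwer's theorem then gives an eigenvector \<open>H\<close> of \<open>L*\<close> in that face
  (\<open>eigenvector_in_face\<close>). Finally \<open>S\<close> forces the eigenvalue of \<open>H\<close> to be nonpositive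
  (\<open>eigenvalue_nonpos\<close>): if it were positive, the largest \<open>t\<close> with \<open>t H \<le> S\<close> could be increased.
\<close>

section \<open>Positive semidefinite matrices\<close>

text \<open>As a rewrite rule, \<open>transpose_matrix_vector\<close> turns every product with a transpose into a product
  with a row vector, where the lemmas on \<open>*v\<close> no longer apply.\<close>

declare transpose_matrix_vector [simp del]

lemma inner_matrix_vector_transpose: "x \<bullet> (M *v y) = (transpose M *v x) \<bullet> y"
  for M :: "real ^ 'n ^ 'm"
  by (metis dot_lmul_matrix transpose_matrix_vector transpose_transpose)

lemma matrix_eqI: "(\<And>x. M *v x = N *v x) \<Longrightarrow> M = N" for M N :: "real ^ 'n ^ 'n"
  by (simp add: matrix_eq)

lemma psd_sym: "psd M \<Longrightarrow> x \<bullet> (M *v y) = y \<bullet> (M *v x)"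
  by (metis inner_commute inner_matrix_vector_transpose psd_def)

lemma psd_add: "psd M \<Longrightarrow> psd N \<Longrightarrow> psd (M + N)"
  by (simp add: psd_def transpose_add matrix_vector_mult_add_rdistrib inner_add_right)

lemma psd_scaleR: "psd M \<Longrightarrow> 0 \<le> c \<Longrightarrow> psd (c *\<^sub>R M)"
  by (simp add: psd_def transpose_scalar scaleR_matrix_vector_assoc [symmetric])

lemma psd_congruence:
  assumes "psd M"
  shows "psd (B ** M ** transpose B)"
proof -
  have "transpose (B ** M ** transpose B) = B ** M ** transpose B"
    using assms by (simp add: psd_def matrix_transpose_mul matrix_mul_assoc)
  moreover have "0 \<le> x \<bullet> ((B ** M ** transpose B) *v x)" for x
  proof -
    have "x \<bullet> ((B ** M ** transpose B) *v x) = (transpose B *v x) \<bullet> (M *v (transpose B *v x))"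
      by (simp add: matrix_vector_mul_assoc [symmetric] inner_matrix_vector_transpose[of x B])
    then show ?thesis using assms by (simp add: psd_def)
  qed
  ultimately show ?thesis by (simp add: psd_def)
qed

lemma closed_psd: "closed {M :: real ^ 'n ^ 'n. psd M}"
proof -
  have "continuous_on UNIV (\<lambda>M :: real ^ 'n ^ 'n. transpose M)"
    unfolding transpose_def by (intro continuous_intros)
  moreover have "continuous_on UNIV (\<lambda>M :: real ^ 'n ^ 'n. M *v x)" for x
    unfolding matrix_vector_mult_def by (intro continuous_intros)
  ultimately show ?thesis
    unfolding psd_def
    by (intro closed_Collect_conj closed_Collect_all closed_Collect_eq closed_Collect_le continuous_intros)
qed

text \<open>The form of \<open>M\<close> may be degenerate, so the usual division by a diagonal value needs a case
  distinction.\<close>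

lemma psd_Cauchy_Schwarz:
  assumes "psd M"
  shows "(x \<bullet> (M *v y))\<^sup>2 \<le> (x \<bullet> (M *v x)) * (y \<bullet> (M *v y))"
proof -
  define a b c where "a = x \<bullet> (M *v x)" and "b = x \<bullet> (M *v y)" and "c = y \<bullet> (M *v y)"
  have q: "0 \<le> s\<^sup>2 * a + 2 * s * t * b + t\<^sup>2 * c" for s t
  proof -
    have "(s *\<^sub>R x + t *\<^sub>R y) \<bullet> (M *v (s *\<^sub>R x + t *\<^sub>R y)) = s\<^sup>2 * a + 2 * s * t * b + t\<^sup>2 * c"
      using psd_sym[OF assms, of y x]
      by (simp add: a_def b_def c_def matrix_vector_right_distrib matrix_vector_mult_scaleR
          inner_add_left inner_add_right power2_eq_square algebra_simps)
    then show ?thesis using assms unfolding psd_def by metis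
  qed
  have "0 \<le> a" "0 \<le> c" using q[of 1 0] q[of 0 1] by auto
  show "b\<^sup>2 \<le> a * c"
  proof (cases "a = 0")
    case True
    \<comment> \<open>For \<open>a = 0\<close> the form at \<open>s x + y\<close> is \<open>2 s b + c\<close>; the chosen \<open>s\<close> makes it \<open>- 1\<close>.\<close>
    have "b = 0"
    proof (rule ccontr)
      assume "b \<noteq> 0"
      then show False using q[of "- (c + 1) / (2 * b)" 1] True by (simp add: field_simps)
    qed
    then show ?thesis using True by simp
  next
    case False
    have "0 \<le> a * (a * c - b\<^sup>2)"
      using q[of "-b" a] by (simp add: algebra_simps power2_eq_square)
    then show ?thesis using False \<open>0 \<le> a\<close> by (simp add: zero_le_mult_iff)
  qed
qed

lemma psd_null_vector: "psd M \<Longrightarrow> x \<bullet> (M *v x) = 0 \<Longrightarrow> M *v x = 0"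
  using psd_Cauchy_Schwarz[of M "M *v x" x] by simp

definition outer :: "real ^ 'n \<Rightarrow> real ^ 'n ^ 'n" where
  "outer y = (\<chi> i j. y $ i * y $ j)"

lemma outer_mult_vec: "outer y *v x = (y \<bullet> x) *\<^sub>R y"
  by (simp add: outer_def matrix_vector_mult_def vec_eq_iff inner_vec_def sum_distrib_left sum_distrib_right ac_simps)

lemma inner_outer: "M \<bullet> outer y = y \<bullet> (M *v y)"
  by (simp add: outer_def matrix_vector_mult_def inner_vec_def sum_distrib_left ac_simps)

lemma psd_outer: "psd (outer y)"
  unfolding psd_def by (auto simp: outer_mult_vec inner_commute)
    (simp add: outer_def transpose_def vec_eq_iff)

lemma norm_outer: "norm (outer y) = y \<bullet> y"
  by (simp add: norm_eq_sqrt_inner[of "outer y"] inner_outer outer_mult_vec real_sqrt_mult[symmetric])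

text \<open>One step of a Cholesky decomposition: for \<open>N z \<noteq> 0\<close> subtract \<open>(N z) (N z)^T / (z^T N z)\<close>. The
  remainder is positive semidefinite by Cauchy-Schwarz, and \<open>z\<close> has become a new kernel vector.\<close>

lemma psd_deflate:
  assumes N: "psd N" "N \<noteq> 0"
  obtains N' y where "psd N'" "y \<noteq> 0" "N = N' + outer y" "{x. N *v x = 0} \<subset> {x. N' *v x = 0}"
proof -
  obtain z where z: "N *v z \<noteq> 0" using N(2) by (metis matrix_eqI matrix_vector_mult_0)
  define a where "a = z \<bullet> (N *v z)"
  have a: "0 < a" using z N(1) psd_null_vector[of N z] unfolding a_def psd_def by (metis order_le_less)
  define y where "y = (1 / sqrt a) *\<^sub>R (N *v z)"
  have yx: "y \<bullet> x = (x \<bullet> (N *v z)) / sqrt a" for x by (simp add: y_def inner_commute)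
  have N'x: "(N - outer y) *v x = N *v x - (y \<bullet> x) *\<^sub>R y" for x
    by (simp add: matrix_vector_mult_diff_rdistrib outer_mult_vec)
  show ?thesis
  proof
    show "y \<noteq> 0" using z a by (simp add: y_def)
    show "N = (N - outer y) + outer y" by simp
    have "transpose (N - outer y) = N - outer y"
      using N(1) psd_outer[of y] by (simp add: psd_def transpose_def vec_eq_iff)
    moreover have "0 \<le> x \<bullet> ((N - outer y) *v x)" for x
      using psd_Cauchy_Schwarz[OF N(1), of x z] a
      by (simp add: N'x inner_diff_right yx inner_commute[of x y] a_def[symmetric] field_simps power2_eq_square)
    ultimately show "psd (N - outer y)" by (simp add: psd_def)
    have "(N - outer y) *v x = 0" if "N *v x = 0" for x
      using that psd_sym[OF N(1), of x z] by (simp add: N'x yx)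
    moreover have "(N - outer y) *v z = 0" using a
      by (simp add: N'x yx a_def[symmetric]) (simp add: y_def)
    ultimately show "{x. N *v x = 0} \<subset> {x. (N - outer y) *v x = 0}" using z by blast
  qed
qed

text \<open>Every positive semidefinite matrix is a sum of matrices \<open>y y^T\<close>, by repeated deflation. In the form of
  an induction rule this takes the place of the spectral theorem below.\<close>

lemma psd_induct [consumes 1, case_names zero add_outer]:
  fixes N :: "real ^ 'n ^ 'n"
  assumes "psd N" and zero: "P 0" and add: "\<And>N y. psd N \<Longrightarrow> P N \<Longrightarrow> P (N + outer y)"
  shows "P N"
  using assms(1)
proof (induction "DIM(real ^ 'n) - dim {x. N *v x = 0}" arbitrary: N rule: less_induct)
  case less
  show ?case
  proof (cases "N = 0")
    case True
    then show ?thesis using zero by simp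
  next
    case False
    then obtain N' y where N': "psd N'" "N = N' + outer y" "{x. N *v x = 0} \<subset> {x. N' *v x = 0}"
      using psd_deflate less.prems by metis
    have sub: "subspace {x. M *v x = 0}" for M :: "real ^ 'n ^ 'n"
      by (auto simp: subspace_def matrix_vector_right_distrib matrix_vector_mult_scaleR)
    have "dim {x. N *v x = 0} < dim {x. N' *v x = 0}"
    proof (rule dim_psubset)
      show "span {x. N *v x = 0} \<subset> span {x. N' *v x = 0}"
        unfolding span_eq_iff[THEN iffD2, OF sub] by (rule N'(3))
    qed
    moreover have "dim {x. N' *v x = 0} \<le> DIM(real ^ 'n)" by (rule dim_subset_UNIV)
    ultimately have "P N'" using less.hyps N'(1) by (meson diff_less_mono2 order_less_le_trans)
    then show ?thesis using add N' by blast
  qed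
qed

lemma inner_psd_nonneg: "psd M \<Longrightarrow> psd N \<Longrightarrow> 0 \<le> M \<bullet> N"
proof (rotate_tac, induction rule: psd_induct)
  case zero
  then show ?case by simp
next
  case (add_outer N y)
  then show ?case by (simp add: inner_add_right inner_outer psd_def)
qed

lemma pd_imp_psd: "pd M \<Longrightarrow> psd M"
  unfolding pd_def psd_def by (metis inner_zero_left order.refl order_less_imp_le)

lemma inner_pd_pos: 
  assumes "pd M" "psd N" "N \<noteq> 0"
  shows "0 < M \<bullet> N"
proof -
  obtain N' y where "psd N'" "y \<noteq> 0" "N = N' + outer y"
    using psd_deflate assms(2,3) by metis
  then show ?thesis
    using inner_psd_nonneg[of M N'] assms(1) pd_imp_psd[of M]
    by (auto simp: inner_add_right inner_outer pd_def add_nonneg_pos)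
qed

lemma pd_mat_1: "pd (mat 1)"
  by (simp add: pd_def)

text \<open>This bounds the slices of the cone by a trace condition, which makes them compact.\<close>

lemma norm_le_trace: "psd M \<Longrightarrow> norm M \<le> mat 1 \<bullet> M"
proof (induction rule: psd_induct)
  case (add_outer N y)
  then show ?case using norm_triangle_ineq[of N "outer y"] by (simp add: inner_add_right inner_outer norm_outer)
qed simp

text \<open>If \<open>y\<close> is orthogonal to the kernel of the symmetric matrix \<open>D\<close>, then \<open>y = D z\<close> for some \<open>z\<close>, and
  Cauchy-Schwarz gives \<open>y y^T \<le> (z^T D z) D\<close>. Summing over a decomposition of \<open>H\<close> gives the claim: \<open>D\<close>
  lies in the relative interior of the face that its kernel determines.\<close>

lemma psd_dominates:
  assumes D: "psd D" and H: "psd H" and ker: "\<And>x. D *v x = 0 \<Longrightarrow> H *v x = 0"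
  shows "\<exists>c\<ge>0. psd (c *\<^sub>R D - H)"
  using H ker
proof (induction rule: psd_induct)
  case zero
  then show ?case using D by (auto intro: exI[of _ 0] simp: psd_def transpose_def vec_eq_iff)
next
  case (add_outer N y)
  have kN: "N *v x = 0" and ky: "y \<bullet> x = 0" if "D *v x = 0" for x
  proof -
    have "(N + outer y) *v x = 0" using add_outer.prems that by blast
    then have "x \<bullet> ((N + outer y) *v x) = 0" by simp
    then have "x \<bullet> (N *v x) + (y \<bullet> x)\<^sup>2 = 0"
      by (simp add: matrix_vector_mult_add_rdistrib outer_mult_vec inner_add_right
          inner_commute[of x y] power2_eq_square)
    moreover have "0 \<le> x \<bullet> (N *v x)" using \<open>psd N\<close> by (simp add: psd_def)
    moreover have "0 \<le> (y \<bullet> x)\<^sup>2" by simp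
    ultimately have "x \<bullet> (N *v x) = 0" "(y \<bullet> x)\<^sup>2 = 0" by linarith+
    then have "x \<bullet> (N *v x) = 0" "y \<bullet> x = 0" by simp_all
    then show "N *v x = 0" "y \<bullet> x = 0" using psd_null_vector \<open>psd N\<close> by blast+
  qed
  obtain c where c: "c \<ge> 0" "psd (c *\<^sub>R D - N)" using add_outer.IH kN by blast
  have "y \<in> range ((*v) D)"
  proof -
    have "adjoint ((*v) D) = (*v) D"
      using D adjoint_matrix[of D] by (simp add: psd_def fun_eq_iff)
    then have "(range ((*v) D))\<^sup>\<bottom> = {x. D *v x = 0}"
      using ker_orthogonal_comp_adjoint[of "(*v) D"] by (auto simp: matrix_vector_mul_linear)
    then have "y \<in> ((range ((*v) D))\<^sup>\<bottom>)\<^sup>\<bottom>"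
      using ky by (auto simp: orthogonal_comp_def orthogonal_def inner_commute)
    then show ?thesis
      by (simp add: orthogonal_comp_self linear_subspace_image subspace_UNIV matrix_vector_mul_linear)
  qed
  then obtain z where z: "y = D *v z" by blast
  define e where "e = z \<bullet> (D *v z)"
  have e: "0 \<le> e" using D by (simp add: e_def psd_def)
  have "psd (e *\<^sub>R D - outer y)"
  proof -
    have "transpose (e *\<^sub>R D - outer y) = e *\<^sub>R D - outer y"
      using D psd_outer[of y] by (simp add: psd_def transpose_def vec_eq_iff)
    moreover have "0 \<le> x \<bullet> ((e *\<^sub>R D - outer y) *v x)" for x
      using psd_Cauchy_Schwarz[OF D, of x z] z
      by (simp add: matrix_vector_mult_diff_rdistrib outer_mult_vec inner_diff_right inner_commute e_def
          scaleR_matrix_vector_assoc [symmetric] power2_eq_square mult.commute)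
    ultimately show ?thesis by (simp add: psd_def)
  qed
  then have "psd ((c + e) *\<^sub>R D - (N + outer y))"
    using psd_add[OF c(2), of "e *\<^sub>R D - outer y"] by (simp add: algebra_simps)
  then show ?case using c(1) e by (intro exI[of _ "c + e"]) auto
qed

section \<open>The adjoint Lyapunov operator and kernels of positive semidefinite matrices\<close>

lemma lyap_adj_mult_vec:
  "lyap_adj A C M *v x = A *v (M *v x) + M *v (transpose A *v x) + C *v (M *v (transpose C *v x))"
  by (simp add: lyap_adj_def matrix_vector_mult_add_rdistrib matrix_vector_mul_assoc matrix_mul_assoc)

lemma linear_lyap_adj: "linear (lyap_adj A C)"
  by (rule linearI) (auto intro!: matrix_eqI
      simp: lyap_adj_mult_vec matrix_vector_mult_add_rdistrib matrix_vector_right_distrib algebra_simps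
       scaleR_matrix_vector_assoc [symmetric] matrix_vector_mult_scaleR)

text \<open>The part \<open>A D + D A^T\<close> vanishes in the quadratic form at a kernel vector of \<open>D\<close>, and what is left
  is nonnegative: this is how \<open>L*\<close> respects the boundary of the cone.\<close>

lemma inner_lyap_adj_null:
  assumes "psd D" "D *v x = 0"
  shows "x \<bullet> (lyap_adj A C D *v x) = (transpose C *v x) \<bullet> (D *v (transpose C *v x))"
  using assms psd_sym[of D x "transpose A *v x"]
  by (simp add: lyap_adj_mult_vec inner_add_right inner_matrix_vector_transpose[of _ C])

text \<open>By \<open>inner_lyap_adj_null\<close> the form of \<open>L* S\<close> at \<open>x\<close> is nonnegative, and \<open>L* S \<le> 0\<close> makes it
  nonpositive. It vanishes, so \<open>C^T x\<close> is a null vector of \<open>S\<close> and \<open>x\<close> one of \<open>L* S\<close>. What remains of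
  \<open>L* S x = 0\<close> is \<open>S A^T x = 0\<close>.\<close>

lemma kernel_invariant:
  assumes S: "psd S" "lyap_adj A C S \<preceq>\<^sub>L 0" and x: "S *v x = 0"
  shows "S *v (transpose A *v x) = 0" and "S *v (transpose C *v x) = 0"
proof -
  have n: "psd (- lyap_adj A C S)" using S(2) by (simp add: loewner_le_def)
  have neg: "(- lyap_adj A C S) *v x = - (lyap_adj A C S *v x)"
    by (metis matrix_vector_mult_diff_rdistrib diff_0 matrix_vector_mult_0)
  have "0 \<le> (transpose C *v x) \<bullet> (S *v (transpose C *v x))" using S by (simp add: psd_def)
  moreover have "x \<bullet> (lyap_adj A C S *v x) \<le> 0"
    using n neg unfolding psd_def by (metis inner_minus_right neg_0_le_iff_le)
  ultimately have *: "x \<bullet> (lyap_adj A C S *v x) = 0" 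
    and "(transpose C *v x) \<bullet> (S *v (transpose C *v x)) = 0"
    using inner_lyap_adj_null[OF S(1) x, of A C] by auto
  then show C: "S *v (transpose C *v x) = 0" using psd_null_vector S(1) by blast
  have "lyap_adj A C S *v x = 0"
    using psd_null_vector[OF n, of x] * neg by simp
  then show "S *v (transpose A *v x) = 0" using C x by (simp add: lyap_adj_mult_vec)
qed

section \<open>Eigenvectors below a supersolution\<close>

text \<open>Suppose \<open>l > 0\<close>, take the largest \<open>t\<close> with \<open>t H \<le> S\<close> and put \<open>D = S - t H\<close>. For \<open>t > 0\<close>,
  \<open>L* D \<le> - t l H\<close>, while the form of \<open>L* D\<close> is nonnegative on the kernel of \<open>D\<close>; hence that kernel lies
  in the kernel of \<open>H\<close>, as it does by hypothesis for \<open>t = 0\<close>. But then \<open>D\<close> dominates a positive multiple of \<open>H\<close>, and \<open>t\<close> was not maximal.\<close>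

lemma eigenvalue_nonpos:
  assumes S: "psd S" "lyap_adj A C S \<preceq>\<^sub>L 0"
    and H: "psd H" "H \<noteq> 0" "lyap_adj A C H = l *\<^sub>R H"
    and ker: "\<And>x. S *v x = 0 \<Longrightarrow> H *v x = 0"
  shows "l \<le> 0"
proof (rule ccontr)
  assume "\<not> l \<le> 0"
  define T where "T = {t. 0 \<le> t \<and> psd (S - t *\<^sub>R H)}"
  have trH: "0 < mat 1 \<bullet> H" by (rule inner_pd_pos[OF pd_mat_1 H(1,2)])
  have bd: "t \<le> (mat 1 \<bullet> S) / (mat 1 \<bullet> H)" if "t \<in> T" for t
    using inner_psd_nonneg[OF pd_imp_psd[OF pd_mat_1], of "S - t *\<^sub>R H"] that trH
    by (simp add: T_def inner_diff_right field_simps)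
  have "closed T"
  proof -
    have "closed ({0..} \<inter> (\<lambda>t. S - t *\<^sub>R H) -` {M. psd M})"
      by (intro closed_Int closed_atLeast continuous_closed_vimage closed_psd continuous_intros)
    then show ?thesis by (simp add: T_def vimage_def Int_def)
  qed
  moreover have "bounded T"
    by (rule bounded_subset[OF bounded_closed_interval[of 0 "(mat 1 \<bullet> S) / (mat 1 \<bullet> H)"]])
       (use bd in \<open>auto simp: T_def\<close>)
  moreover have "0 \<in> T" using S by (simp add: T_def)
  ultimately obtain t where t: "t \<in> T" and mx: "\<And>s. s \<in> T \<Longrightarrow> s \<le> t"
    using compact_attains_sup[of T] compact_eq_bounded_closed by (metis empty_iff)
  define D where "D = S - t *\<^sub>R H"
  have D: "psd D" and "0 \<le> t" using t by (auto simp: T_def D_def)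
  have "H *v x = 0" if x: "D *v x = 0" for x
  proof (cases "t = 0")
    case True
    then show ?thesis using ker x by (simp add: D_def)
  next
    case False
    have "lyap_adj A C D = lyap_adj A C S - (t * l) *\<^sub>R H"
      using linear_lyap_adj[of A C] H(3) by (simp add: D_def linear_diff linear_scale)
    then have "x \<bullet> (lyap_adj A C D *v x) = x \<bullet> (lyap_adj A C S *v x) - t * l * (x \<bullet> (H *v x))"
      by (simp add: matrix_vector_mult_diff_rdistrib inner_diff_right scaleR_matrix_vector_assoc [symmetric])
    moreover have "0 \<le> x \<bullet> (lyap_adj A C D *v x)"
      using inner_lyap_adj_null[OF D x, of A C] D by (simp add: psd_def)
    moreover have "x \<bullet> (lyap_adj A C S *v x) \<le> 0"
    proof -
      have "0 \<le> x \<bullet> ((0 - lyap_adj A C S) *v x)" using S(2) unfolding psd_def loewner_le_def by blast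
      then show ?thesis by (simp only: matrix_vector_mult_diff_rdistrib) (simp add: inner_diff_right)
    qed
    ultimately have le: "(t * l) * (x \<bullet> (H *v x)) \<le> 0" by linarith
    have "0 < t * l" using False \<open>0 \<le> t\<close> \<open>\<not> l \<le> 0\<close> by simp
    then have "x \<bullet> (H *v x) \<le> 0" using le by (metis mult_pos_pos not_le)
    moreover have "0 \<le> x \<bullet> (H *v x)" using H(1) by (simp add: psd_def)
    ultimately have "x \<bullet> (H *v x) = 0" by linarith
    then show ?thesis using psd_null_vector H(1) by blast
  qed
  \<comment> \<open>Passing from \<open>c\<close> to \<open>c + 1\<close> keeps the domination and gives a positive divisor at once.\<close>
  then obtain c where c: "0 \<le> c" "psd (c *\<^sub>R D - H)" using psd_dominates[OF D H(1)] by blast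
  have "psd ((c + 1) *\<^sub>R D - H)" using psd_add[OF c(2) D] by (simp add: algebra_simps)
  then have "psd ((1 / (c + 1)) *\<^sub>R ((c + 1) *\<^sub>R D - H))" using c(1) by (intro psd_scaleR) auto
  moreover have "(1 / (c + 1)) *\<^sub>R ((c + 1) *\<^sub>R D - H) = D - (1 / (c + 1)) *\<^sub>R H"
    using c(1) by (simp only: scaleR_diff_right scaleR_scaleR) simp
  moreover have "\<dots> = S - (t + 1 / (c + 1)) *\<^sub>R H"
    by (simp add: D_def scaleR_add_left)
  ultimately have "t + 1 / (c + 1) \<in> T" using \<open>0 \<le> t\<close> c(1) by (simp add: T_def)
  then show False using mx c(1) by fastforce
qed

text \<open>Let \<open>F\<close> be the face of \<open>S\<close>, \<open>K\<close> its trace-one slice, and \<open>V H = L* H - tr (L* H) H\<close>, so that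
  eigenvectors in \<open>K\<close> are the zeros of \<open>V\<close>. Brouwer's theorem applied to the projection of \<open>H + V H\<close> onto
  \<open>K\<close> gives \<open>H\<close> at which \<open>V H\<close> is an outward normal of \<open>K\<close>. But \<open>V H\<close> is also tangent to \<open>K\<close>,
  since \<open>H + e L* H + e^2 A H A^T\<close> lies in \<open>F\<close> for all \<open>e > 0\<close>. Both together force \<open>V H = 0\<close>.\<close>

lemma eigenvector_in_face:
  fixes A C S :: "real ^ 'n ^ 'n"
  assumes S: "psd S" "S \<noteq> 0" "lyap_adj A C S \<preceq>\<^sub>L 0"
  obtains H l where "psd H" "H \<noteq> 0" "lyap_adj A C H = l *\<^sub>R H" "\<And>x. S *v x = 0 \<Longrightarrow> H *v x = 0"
proof -
  define F where "F = {H. psd H \<and> (\<forall>x. S *v x = 0 \<longrightarrow> H *v x = 0)}"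
  define tr where "tr = (\<lambda>H :: real ^ 'n ^ 'n. mat 1 \<bullet> H)"
  define K where "K = {H \<in> F. tr H = 1}"
  have F_add: "G + H \<in> F" if "G \<in> F" "H \<in> F" for G H
    using that by (auto simp: F_def psd_add matrix_vector_mult_add_rdistrib)
  have F_scale: "c *\<^sub>R H \<in> F" if "H \<in> F" "0 \<le> c" for c H
    using that by (auto simp: F_def psd_scaleR scaleR_matrix_vector_assoc [symmetric])
  have tr_pos: "0 < tr H" if "H \<in> F" "H \<noteq> 0" for H
    using inner_pd_pos[OF pd_mat_1, of H] that by (simp add: F_def tr_def)
  have "convex K"
    by (rule convexI) (auto simp: K_def F_add F_scale tr_def inner_add_right)
  have "closed K"
  proof -
    have cm: "continuous_on UNIV (\<lambda>M :: real ^ 'n ^ 'n. M *v x)" for x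
      unfolding matrix_vector_mult_def by (intro continuous_intros)
    have "closed {H. (psd H \<and> (\<forall>x. S *v x = 0 \<longrightarrow> H *v x = 0)) \<and> tr H = 1}"
      unfolding tr_def
      by (intro closed_Collect_conj closed_psd closed_Collect_all closed_Collect_imp open_Collect_const
          closed_Collect_eq cm continuous_intros)
    then show ?thesis by (simp add: K_def F_def)
  qed
  moreover have "bounded K"
    unfolding bounded_iff K_def F_def tr_def using norm_le_trace by (intro exI[of _ 1]) fastforce
  ultimately have "compact K" by (simp add: compact_eq_bounded_closed)
  have normalise: "(1 / tr H) *\<^sub>R H \<in> K" if "H \<in> F" "H \<noteq> 0" for H
    using tr_pos[OF that] that F_scale[of H "1 / tr H"] by (simp add: K_def tr_def)
  have "S \<in> F" using S(1) by (simp add: F_def)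
  then have "K \<noteq> {}" using normalise S(2) by blast
  define V where "V = (\<lambda>H. lyap_adj A C H - tr (lyap_adj A C H) *\<^sub>R H)"
  have "linear (lyap_adj A C)" by (rule linear_lyap_adj)
  then have cont: "continuous_on X (lyap_adj A C)" for X by (simp add: linear_continuous_on linear_linear)
  have "continuous_on K (\<lambda>H. H + V H)"
    unfolding V_def tr_def by (intro continuous_intros cont)
  then have "continuous_on K (\<lambda>H. closest_point K (H + V H))"
    using continuous_on_compose2[OF continuous_on_closest_point[of K UNIV]]
      \<open>convex K\<close> \<open>closed K\<close> \<open>K \<noteq> {}\<close> by blast
  then obtain H where H: "H \<in> K" "closest_point K (H + V H) = H"
    using brouwer[of K "\<lambda>H. closest_point K (H + V H)"] \<open>compact K\<close> \<open>convex K\<close> \<open>K \<noteq> {}\<close> \<open>closed K\<close>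
      closest_point_in_set by blast
  then have HF: "H \<in> F" "tr H = 1" by (auto simp: K_def)
  \<comment> \<open>The normal cone inequality, in a homogeneous form that holds on all of \<open>F\<close>.\<close>
  have var: "V H \<bullet> G \<le> tr G * (V H \<bullet> H)" if "G \<in> F" for G
  proof (cases "G = 0")
    case True
    then show ?thesis by (simp add: tr_def)
  next
    case False
    have "(H + V H - H) \<bullet> ((1 / tr G) *\<^sub>R G - H) \<le> 0"
      using closest_point_dot[of K "(1 / tr G) *\<^sub>R G" "H + V H"] \<open>convex K\<close> \<open>closed K\<close> normalise[OF that False] H(2)
      by simp
    then show ?thesis using tr_pos[OF that False] by (simp add: inner_diff_right field_simps)
  qed
  \<comment> \<open>The second-order term \<open>W\<close> completes \<open>H + e L* H\<close> to a sum of two congruences of \<open>H\<close>.\<close>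
  define W where "W = A ** H ** transpose A"
  have step: "H + e *\<^sub>R lyap_adj A C H + e\<^sup>2 *\<^sub>R W \<in> F" if "0 < e" for e
  proof -
    define B where "B = mat 1 + e *\<^sub>R A"
    have tB: "transpose B *v x = x + e *\<^sub>R (transpose A *v x)" for x
      by (simp add: B_def transpose_add transpose_scalar matrix_vector_mult_add_rdistrib scaleR_matrix_vector_assoc [symmetric])
    have eq: "H + e *\<^sub>R lyap_adj A C H + e\<^sup>2 *\<^sub>R W = B ** H ** transpose B + e *\<^sub>R (C ** H ** transpose C)"
      by (rule matrix_eqI)
       (simp add: W_def matrix_vector_mult_add_rdistrib scaleR_matrix_vector_assoc [symmetric] 
         lyap_adj_mult_vec matrix_vector_mul_assoc [symmetric] tB,
        simp add: B_def matrix_vector_mult_add_rdistrib scaleR_matrix_vector_assoc [symmetric]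
         matrix_vector_right_distrib matrix_vector_mult_scaleR power2_eq_square algebra_simps)
    have "psd (B ** H ** transpose B + e *\<^sub>R (C ** H ** transpose C))"
      using HF that by (intro psd_add psd_scaleR psd_congruence) (auto simp: F_def)
    moreover have "(B ** H ** transpose B + e *\<^sub>R (C ** H ** transpose C)) *v x = 0" if x: "S *v x = 0" for x
    proof -
      have "H *v x = 0" "H *v (transpose A *v x) = 0" "H *v (transpose C *v x) = 0"
        using HF(1) x kernel_invariant[OF S(1,3) x] by (auto simp: F_def)
      then show ?thesis
        by (simp add: matrix_vector_mult_add_rdistrib scaleR_matrix_vector_assoc [symmetric]
          matrix_vector_mul_assoc [symmetric] tB matrix_vector_right_distrib matrix_vector_mult_scaleR)
    qed
    ultimately show ?thesis unfolding eq F_def by blast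
  qed
  define w where "w = V H \<bullet> W - tr W * (V H \<bullet> H)"
  have le: "V H \<bullet> V H + e * w \<le> 0" if "0 < e" for e
  proof -
    have "e * (V H \<bullet> V H + e * w) \<le> 0"
    proof -
      have VV: "V H \<bullet> V H = V H \<bullet> lyap_adj A C H - tr (lyap_adj A C H) * (V H \<bullet> H)"
        by (subst (2) V_def) (simp add: inner_diff_right)
      show ?thesis
        unfolding VV w_def
        using var[OF step[OF that]] HF(2) by (simp add: tr_def inner_add_right algebra_simps power2_eq_square)
    qed
    then show ?thesis using that by (simp add: mult_le_0_iff)
  qed
  have "V H \<bullet> V H \<le> 0"
  proof (rule ccontr)
    assume *: "\<not> V H \<bullet> V H \<le> 0"
    \<comment> \<open>So small that the second-order term is at most half of the first-order one.\<close>
    define e where "e = (V H \<bullet> V H) / (2 * (\<bar>w\<bar> + 1))"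
    have "0 < e" using * unfolding e_def by (intro divide_pos_pos) auto
    have "e * (- w) \<le> e * (\<bar>w\<bar> + 1)" using \<open>0 < e\<close> by (intro mult_left_mono) auto
    also have "\<dots> = (V H \<bullet> V H) / 2" unfolding e_def by (simp add: field_simps)
    finally show False using le[OF \<open>0 < e\<close>] * by linarith
  qed
  then have "V H = 0" by (metis inner_eq_zero_iff inner_ge_zero order.antisym)
  then have "lyap_adj A C H = tr (lyap_adj A C H) *\<^sub>R H" by (simp add: V_def)
  moreover have "psd H" "H \<noteq> 0" "S *v x = 0 \<Longrightarrow> H *v x = 0" for x
    using HF by (auto simp: F_def tr_def)
  ultimately show ?thesis using that by blast
qed

section \<open>The theorem of the alternative\<close>

lemma lyap_positive_imp_no_supersolution:
  assumes "pd P" "0 \<prec>\<^sub>L lyap A C P" "psd S" "lyap_adj A C S \<preceq>\<^sub>L 0"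
  shows "S = 0"
proof (rule ccontr)
  assume "S \<noteq> 0"
  then have "0 < lyap A C P \<bullet> S" using inner_pd_pos assms by (simp add: loewner_less_def)
  moreover have "0 \<le> P \<bullet> (0 - lyap_adj A C S)" 
    using assms inner_psd_nonneg pd_imp_psd unfolding loewner_le_def by blast
  ultimately show False by (simp add: lyap_adjoint)
qed

text \<open>Symmetric matrices do not see the skew part of a functional, so a separating functional may be
  taken symmetric.\<close>

lemma inner_symmetric_part:
  fixes M N :: "real ^ 'n ^ 'n"
  assumes "transpose N = N"
  shows "((1 / 2) *\<^sub>R (M + transpose M)) \<bullet> N = M \<bullet> N"
proof -
  have "transpose M \<bullet> N = transpose M \<bullet> transpose N" using assms by simp
  also have "\<dots> = M \<bullet> N" unfolding inner_vec_def transpose_def by (simp, rule sum.swap)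
  finally show ?thesis by (simp add: inner_add_left)
qed

text \<open>The slack \<open>Q\<close> shares the trace normalisation with \<open>S\<close>. This makes the set to be separated from \<open>0\<close>
  compact, and lets the points with \<open>S = 0\<close> witness that the separating \<open>P\<close> is definite and not only
  semidefinite.\<close>

lemma no_supersolution_imp_lyap_positive:
  fixes A C :: "real ^ 'n ^ 'n"
  assumes none: "\<And>S. psd S \<Longrightarrow> lyap_adj A C S \<preceq>\<^sub>L 0 \<Longrightarrow> S = 0"
  obtains P where "pd P" "0 \<prec>\<^sub>L lyap A C P"
proof -
  define K where "K = {(S :: real ^ 'n ^ 'n, Q :: real ^ 'n ^ 'n).
      psd S \<and> psd Q \<and> mat 1 \<bullet> S + mat 1 \<bullet> Q = (1 :: real)}"
  define f where "f = (\<lambda>(S, Q). lyap_adj A C S + Q)"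
  have lin: "linear f"
    using linear_lyap_adj[of A C] unfolding f_def case_prod_beta
    by (auto intro!: linearI simp: linear_add linear_scale algebra_simps)
  have "convex K"
  proof (rule convexI)
    fix z z' and u v :: real
    assume z: "z \<in> K" "z' \<in> K" and u: "0 \<le> u" "0 \<le> v" "u + v = 1"
    have tr: "mat 1 \<bullet> fst z + mat 1 \<bullet> snd z = 1" "mat 1 \<bullet> fst z' + mat 1 \<bullet> snd z' = 1"
      using z by (auto simp: K_def)
    have "mat 1 \<bullet> (u *\<^sub>R fst z + v *\<^sub>R fst z') + mat 1 \<bullet> (u *\<^sub>R snd z + v *\<^sub>R snd z')
        = u * (mat 1 \<bullet> fst z + mat 1 \<bullet> snd z) + v * (mat 1 \<bullet> fst z' + mat 1 \<bullet> snd z')"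
      by (simp add: inner_add_right distrib_left)
    then have "mat 1 \<bullet> (u *\<^sub>R fst z + v *\<^sub>R fst z') + mat 1 \<bullet> (u *\<^sub>R snd z + v *\<^sub>R snd z') = 1"
      using tr u(3) by simp
    moreover have "psd (u *\<^sub>R fst z + v *\<^sub>R fst z')" "psd (u *\<^sub>R snd z + v *\<^sub>R snd z')"
      using z u by (auto simp: K_def intro!: psd_add psd_scaleR)
    ultimately show "u *\<^sub>R z + v *\<^sub>R z' \<in> K" by (simp add: K_def case_prod_beta)
  qed
  have "closed K"
  proof -
    have "closed ((fst -` {M. psd M}) \<inter> (snd -` {M. psd M}) \<inter> {z. mat 1 \<bullet> fst z + mat 1 \<bullet> snd z = (1 :: real)}
       :: ((real ^ 'n ^ 'n) \<times> (real ^ 'n ^ 'n)) set)"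
      by (intro closed_Int continuous_closed_vimage closed_psd closed_Collect_eq continuous_intros)
    moreover have "K = (fst -` {M. psd M}) \<inter> (snd -` {M. psd M}) \<inter> {z. mat 1 \<bullet> fst z + mat 1 \<bullet> snd z = 1}"
      by (auto simp: K_def)
    ultimately show ?thesis by simp
  qed
  moreover have "bounded K"
    unfolding bounded_iff
  proof (intro exI ballI)
    fix z assume "z \<in> K"
    then show "norm z \<le> 1"
      using norm_le_trace[of "fst z"] norm_le_trace[of "snd z"] norm_Pair_le[of "fst z" "snd z"] by (auto simp: K_def)
  qed
  ultimately have "compact K" by (simp add: compact_eq_bounded_closed)
  then have "compact (f ` K)" using lin by (intro compact_continuous_image) (simp_all add: linear_continuous_on linear_linear)
  then have "closed (f ` K)" by (rule compact_imp_closed)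
  moreover have "convex (f ` K)" using lin \<open>convex K\<close> by (rule convex_linear_image)
  moreover have "0 \<notin> f ` K"
  proof
    assume "0 \<in> f ` K"
    then obtain S Q where SQ: "psd S" "psd Q" "mat 1 \<bullet> S + mat 1 \<bullet> Q = (1 :: real)" "lyap_adj A C S + Q = 0"
      by (auto simp: K_def f_def)
    then have "Q = 0 - lyap_adj A C S" by (simp add: eq_neg_iff_add_eq_0 add.commute)
    then have "S = 0" using none SQ(1,2) by (simp add: loewner_le_def)
    moreover have "lyap_adj A C 0 = 0" using linear_lyap_adj linear_0 by blast
    ultimately show False using SQ by simp
  qed
  ultimately obtain R b where R: "0 < b" "\<And>z. z \<in> f ` K \<Longrightarrow> b < R \<bullet> z"
    using separating_hyperplane_closed_0[of "f ` K"] by blast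
  define P where "P = (1 / 2) *\<^sub>R (R + transpose R)"
  have symP: "transpose P = P" by (simp add: P_def transpose_scalar transpose_add add.commute)
  have pos: "0 < P \<bullet> (lyap_adj A C S + Q)" if "(S, Q) \<in> K" for S Q
  proof -
    have "transpose (lyap_adj A C S + Q) = lyap_adj A C S + Q"
      using that by (simp add: transpose_add transpose_lyap_adj K_def psd_def)
    then have "P \<bullet> (lyap_adj A C S + Q) = R \<bullet> f (S, Q)" unfolding P_def f_def by (simp only: inner_symmetric_part prod.case)
    then show ?thesis using R that by fastforce
  qed
  have z: "psd 0" using psd_scaleR[OF psd_outer, of 0 0] by simp
  have unit: "psd ((1 / (x \<bullet> x)) *\<^sub>R outer x)" for x :: "real ^ 'n"
    by (intro psd_scaleR psd_outer) simp
  have "0 < x \<bullet> (P *v x)" if "x \<noteq> 0" for x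
  proof -
    have "(0, (1 / (x \<bullet> x)) *\<^sub>R outer x) \<in> K" using unit[of x] z that by (simp add: K_def inner_outer)
    from pos[OF this] have "0 < (x \<bullet> (P *v x)) / (x \<bullet> x)"
      using linear_0[OF linear_lyap_adj[of A C]] by (simp add: inner_outer)
    moreover have "0 < x \<bullet> x" using that by simp
    ultimately show ?thesis by (metis zero_less_divide_iff less_asym)
  qed
  then have "pd P" using symP by (simp add: pd_def)
  moreover have "0 < x \<bullet> (lyap A C P *v x)" if "x \<noteq> 0" for x
  proof -
    have "((1 / (x \<bullet> x)) *\<^sub>R outer x, 0) \<in> K" using unit[of x] z that by (simp add: K_def inner_outer)
    from pos[OF this] have "0 < (x \<bullet> (lyap A C P *v x)) / (x \<bullet> x)"
      by (simp add: lyap_adjoint[symmetric] inner_outer)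
    moreover have "0 < x \<bullet> x" using that by simp
    ultimately show ?thesis by (metis zero_less_divide_iff less_asym)
  qed
  then have "0 \<prec>\<^sub>L lyap A C P" using symP by (simp add: pd_def loewner_less_def transpose_lyap)
  ultimately show ?thesis by (rule that)
qed

section \<open>The equivalence\<close>

theorem proposition4p3:
  fixes A C :: "real ^ 'n ^ 'n"
  shows "((\<exists>P. pd P \<and> 0 \<prec>\<^sub>L lyap A C P) \<longleftrightarrow>
            (\<forall>S. psd S \<and> lyap_adj A C S \<preceq>\<^sub>L 0 \<longrightarrow> S = 0)) \<and>
         ((\<forall>S. psd S \<and> lyap_adj A C S \<preceq>\<^sub>L 0 \<longrightarrow> S = 0) \<longleftrightarrow>
            (\<forall>H l. psd H \<and> H \<noteq> 0 \<and> lyap_adj A C H = l *\<^sub>R H \<longrightarrow> 0 < l))"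
    (is "(?i \<longleftrightarrow> ?ii) \<and> (?ii \<longleftrightarrow> ?iii)")
proof (intro conjI iffI)
  assume ?i
  then show ?ii using lyap_positive_imp_no_supersolution by blast
next
  assume ?ii
  then show ?i using no_supersolution_imp_lyap_positive by metis
next
  assume ii: ?ii
  show ?iii
  proof (intro allI impI, rule ccontr)
    fix H l
    assume H: "psd H \<and> H \<noteq> 0 \<and> lyap_adj A C H = l *\<^sub>R H" and "\<not> 0 < l"
    then have "psd ((- l) *\<^sub>R H)" by (intro psd_scaleR) auto
    then have "lyap_adj A C H \<preceq>\<^sub>L 0" using H by (simp add: loewner_le_def)
    then show False using ii H by blast
  qed
next
  assume iii: ?iii
  show ?ii
  proof (intro allI impI, rule ccontr)
    fix S
    assume S: "psd S \<and> lyap_adj A C S \<preceq>\<^sub>L 0" and "S \<noteq> 0"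
    then obtain H l where H: "psd H" "H \<noteq> 0" "lyap_adj A C H = l *\<^sub>R H"
      and ker: "\<And>x. S *v x = 0 \<Longrightarrow> H *v x = 0"
      using eigenvector_in_face by metis
    then have "l \<le> 0" using eigenvalue_nonpos S by blast
    then show False using iii H by fastforce
  qed
qed

end
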